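(* Let $I$ and $O$ be disjoint finite sets of input and output variables and let $\varphi$ be a syntactically safe LTL formula over $I\cup O$. Then $\varphi$ is unrealizable if and only if there exists a finite counterexample for $\varphi$.
   Context: Syntactically safe LTL formulas are those generated by $\varphi::=x\mid\neg x\mid\varphi\vee\varphi\mid\varphi\wedge\varphi\mid\mathsf{X}\varphi\mid\mathsf{G}\varphi\mid\varphi\,\mathsf{R}\,\varphi$ with $x$ an atomic proposition ($\varphi\,\mathsf{R}\,\psi:=\neg(\neg\varphi\,\mathsf{U}\,\neg\psi)$). An implementation is a function $f:(2^I)^*\to2^O$; it is finite-state if representable by a finite transducer. For $\sigma\in(2^I)^\omega$ the induced run is $w\in(2^{I\cup O})^\omega$ with $w_t=\sigma_t\cup f(\sigma_0\cdots\sigma_{t-1})$. $\varphi$ is realizable if some finite-state implementation makes the induced run of every $\sigma\in(2^I)^\omega$ satisfy $\varphi$, and unrealizable otherwise. A finite counterexample for $\varphi$ is a finite set $\mathcal{P}\subseteq(2^I)^\omega$ such that for every implementation $f$ there is $\sigma\in\mathcal{P}$ whose induced run violates $\varphi$. *)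

theory Defs
  imports "HOL-Library.Omega_Words_Fun"
begin

datatype (atoms: 'a) ltl =
    Atom 'a
  | Neg "'a ltl"
  | Or "'a ltl" "'a ltl"
  | And "'a ltl" "'a ltl"
  | Next "'a ltl"
  | Until "'a ltl" "'a ltl"
  | Globally "'a ltl"

abbreviation Release :: "'a ltl \<Rightarrow> 'a ltl \<Rightarrow> 'a ltl" where
  "Release \<phi> \<psi> \<equiv> Neg (Until (Neg \<phi>) (Neg \<psi>))"

text \<open>A letter of a word is the set of variables that hold at that position.\<close>

fun sat :: "'a set word \<Rightarrow> 'a ltl \<Rightarrow> bool" where
  "sat w (Atom x) \<longleftrightarrow> x \<in> w 0"
| "sat w (Neg \<phi>) \<longleftrightarrow> \<not> sat w \<phi>"
| "sat w (Or \<phi> \<psi>) \<longleftrightarrow> sat w \<phi> \<or> sat w \<psi>"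
| "sat w (And \<phi> \<psi>) \<longleftrightarrow> sat w \<phi> \<and> sat w \<psi>"
| "sat w (Next \<phi>) \<longleftrightarrow> sat (suffix 1 w) \<phi>"
| "sat w (Until \<phi> \<psi>) \<longleftrightarrow> (\<exists>k. sat (suffix k w) \<psi> \<and> (\<forall>j<k. sat (suffix j w) \<phi>))"
| "sat w (Globally \<phi>) \<longleftrightarrow> (\<forall>k. sat (suffix k w) \<phi>)"

inductive syntactically_safe :: "'a ltl \<Rightarrow> bool" where
  "syntactically_safe (Atom x)"
| "syntactically_safe (Neg (Atom x))"
| "syntactically_safe \<phi> \<Longrightarrow> syntactically_safe \<psi> \<Longrightarrow> syntactically_safe (Or \<phi> \<psi>)"
| "syntactically_safe \<phi> \<Longrightarrow> syntactically_safe \<psi> \<Longrightarrow> syntactically_safe (And \<phi> \<psi>)"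
| "syntactically_safe \<phi> \<Longrightarrow> syntactically_safe (Next \<phi>)"
| "syntactically_safe \<phi> \<Longrightarrow> syntactically_safe (Globally \<phi>)"
| "syntactically_safe \<phi> \<Longrightarrow> syntactically_safe \<psi> \<Longrightarrow> syntactically_safe (Release \<phi> \<psi>)"

text \<open>
  Variables come from an ambient type; \<open>Inp\<close> and \<open>Out\<close> are the sets of input and output
  variables (the name \<open>O\<close> is taken by relation composition). An implementation is a HOL function
  whose values matter only on words over \<open>Pow Inp\<close>.
\<close>

definition implementation :: "'a set \<Rightarrow> 'a set \<Rightarrow> ('a set list \<Rightarrow> 'a set) \<Rightarrow> bool" where
  "implementation Inp Out f \<longleftrightarrow> (\<forall>u \<in> lists (Pow Inp). f u \<subseteq> Out)"

definition input_words :: "'a set \<Rightarrow> 'a set word set" where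
  "input_words Inp = {\<sigma>. \<forall>t. \<sigma> t \<subseteq> Inp}"

text \<open>The output at time \<open>t\<close> depends only on the inputs before time \<open>t\<close>.\<close>

definition run :: "('a set list \<Rightarrow> 'a set) \<Rightarrow> 'a set word \<Rightarrow> 'a set word" where
  "run f \<sigma> = (\<lambda>t. \<sigma> t \<union> f (prefix t \<sigma>))"

text \<open>
  As the output does not depend on the current input, the transducers are Moore machines: the
  state reached by the inputs read so far determines the output.
\<close>

record ('q, 'a) transducer =
  states :: "'q set"
  initial :: 'q
  step :: "'q \<Rightarrow> 'a set \<Rightarrow> 'q"
  label :: "'q \<Rightarrow> 'a set"

definition finite_transducer :: "'a set \<Rightarrow> 'a set \<Rightarrow> ('q, 'a) transducer \<Rightarrow> bool" where
  "finite_transducer Inp Out T \<longleftrightarrow>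
     finite (states T) \<and> initial T \<in> states T \<and>
     (\<forall>q \<in> states T. \<forall>a \<in> Pow Inp. step T q a \<in> states T) \<and>
     (\<forall>q \<in> states T. label T q \<subseteq> Out)"

text \<open>States are taken from \<^typ>\<open>nat\<close>; up to renaming this covers every finite state set.\<close>

definition finite_state :: "'a set \<Rightarrow> 'a set \<Rightarrow> ('a set list \<Rightarrow> 'a set) \<Rightarrow> bool" where
  "finite_state Inp Out f \<longleftrightarrow>
     (\<exists>T :: (nat, 'a) transducer. finite_transducer Inp Out T \<and>
        (\<forall>u \<in> lists (Pow Inp). f u = label T (foldl (step T) (initial T) u)))"

definition realizable :: "'a set \<Rightarrow> 'a set \<Rightarrow> 'a ltl \<Rightarrow> bool" where
  "realizable Inp Out \<phi> \<longleftrightarrow>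
     (\<exists>f. implementation Inp Out f \<and> finite_state Inp Out f \<and>
        (\<forall>\<sigma> \<in> input_words Inp. sat (run f \<sigma>) \<phi>))"

abbreviation unrealizable :: "'a set \<Rightarrow> 'a set \<Rightarrow> 'a ltl \<Rightarrow> bool" where
  "unrealizable Inp Out \<phi> \<equiv> \<not> realizable Inp Out \<phi>"

text \<open>Here the implementations range over all functions, not only the finite-state ones.\<close>

definition finite_counterexample ::
  "'a set \<Rightarrow> 'a set \<Rightarrow> 'a ltl \<Rightarrow> 'a set word set \<Rightarrow> bool" where
  "finite_counterexample Inp Out \<phi> P \<longleftrightarrow>
     finite P \<and> P \<subseteq> input_words Inp \<and>
     (\<forall>f. implementation Inp Out f \<longrightarrow> (\<exists>\<sigma> \<in> P. \<not> sat (run f \<sigma>) \<phi>))"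

end

theory Submission
  imports Defs
begin

text \<open>
  Call a language winning if it has no finite counterexample. If \<open>L\<close> is winning, then some output
  \<open>b\<close> makes the derivative of \<open>L\<close> by \<open>i \<union> b\<close> winning for every input \<open>i\<close>: otherwise, for each of
  the finitely many \<open>b\<close> there are an input \<open>i\<close> and a finite counterexample for the derivative, and
  prefixing these by the respective inputs gives a finite counterexample for \<open>L\<close>. Always choosing
  such an output keeps the residual language winning, hence nonempty, along every run, so that no
  bad prefix ever occurs, which suffices for a safety language. The choice depends only on the
  residual, and an LTL language has only finitely many residuals because the truth of \<open>\<phi>\<close> on
  \<open>u \<frown> w\<close> depends on \<open>w\<close> only through the set of subformulas of \<open>\<phi>\<close> that hold in \<open>w\<close>.
\<close>

section \<open>Finitely many residuals of an LTL language\<close>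

primrec subformulas :: "'a ltl \<Rightarrow> 'a ltl set" where
  "subformulas (Atom x) = {Atom x}"
| "subformulas (Neg \<phi>) = insert (Neg \<phi>) (subformulas \<phi>)"
| "subformulas (Or \<phi> \<psi>) = insert (Or \<phi> \<psi>) (subformulas \<phi> \<union> subformulas \<psi>)"
| "subformulas (And \<phi> \<psi>) = insert (And \<phi> \<psi>) (subformulas \<phi> \<union> subformulas \<psi>)"
| "subformulas (Next \<phi>) = insert (Next \<phi>) (subformulas \<phi>)"
| "subformulas (Until \<phi> \<psi>) = insert (Until \<phi> \<psi>) (subformulas \<phi> \<union> subformulas \<psi>)"
| "subformulas (Globally \<phi>) = insert (Globally \<phi>) (subformulas \<phi>)"

lemma finite_subformulas: "finite (subformulas \<phi>)"
  by (induction \<phi>) auto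

lemma subformulas_refl: "\<phi> \<in> subformulas \<phi>"
  by (cases \<phi>) auto

lemma subformulas_trans: "\<psi> \<in> subformulas \<phi> \<Longrightarrow> subformulas \<psi> \<subseteq> subformulas \<phi>"
  by (induction \<phi>) auto

definition residual :: "'b word set \<Rightarrow> 'b list \<Rightarrow> 'b word set" where
  "residual L u = {w. u \<frown> w \<in> L}"

lemma residual_Nil [simp]: "residual L [] = L"
  by (simp add: residual_def)

lemma residual_residual: "residual (residual L u) v = residual L (u @ v)"
  by (simp add: residual_def conc_conc)

lemma ex_nat_iff: "(\<exists>k. P k) \<longleftrightarrow> P 0 \<or> (\<exists>k. P (Suc k))"
  by (metis not0_implies_Suc)

lemma all_nat_iff: "(\<forall>k. P k) \<longleftrightarrow> P 0 \<and> (\<forall>k. P (Suc k))"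
  by (metis not0_implies_Suc)

lemma suffix_Suc_build: "suffix (Suc k) (a ## w) = suffix k w"
  by (simp add: fun_eq_iff)

text \<open>Expansion law: beyond the operands on \<open>a ## w\<close>, only the truth of the
  formula itself on the tail \<open>w\<close> matters, and the formula is one of its own
  subformulas.\<close>

lemma sat_build_Until:
  "sat (a ## w) (Until \<phi> \<psi>) \<longleftrightarrow>
     sat (a ## w) \<psi> \<or> sat (a ## w) \<phi> \<and> sat w (Until \<phi> \<psi>)"
proof -
  have "sat (a ## w) (Until \<phi> \<psi>) \<longleftrightarrow>
      sat (a ## w) \<psi> \<or>
      (\<exists>k. sat (suffix (Suc k) (a ## w)) \<psi> \<and> (\<forall>j<Suc k. sat (suffix j (a ## w)) \<phi>))"
    unfolding sat.simps by (subst ex_nat_iff) simp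
  then show ?thesis
    by (auto simp: All_less_Suc2 suffix_Suc_build simp del: suffix_nth)
qed

lemma sat_build_Globally:
  "sat (a ## w) (Globally \<phi>) \<longleftrightarrow> sat (a ## w) \<phi> \<and> sat w (Globally \<phi>)"
proof -
  have "sat (a ## w) (Globally \<phi>) \<longleftrightarrow>
      sat (a ## w) \<phi> \<and> (\<forall>k. sat (suffix (Suc k) (a ## w)) \<phi>)"
    unfolding sat.simps by (subst all_nat_iff) simp
  then show ?thesis
    by (simp add: suffix_Suc_build)
qed

lemma sat_build_cong:
  assumes "\<forall>\<chi> \<in> subformulas \<phi>. sat w \<chi> \<longleftrightarrow> sat w' \<chi>"
  shows "sat (a ## w) \<phi> \<longleftrightarrow> sat (a ## w') \<phi>"
  using assms
proof (induction \<phi>)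
  case (Next \<phi>)
  then show ?case
    using subformulas_refl[of \<phi>] suffix_Suc_build[of 0 a] by simp
next
  case (Until \<phi> \<psi>)
  then have "sat w (Until \<phi> \<psi>) \<longleftrightarrow> sat w' (Until \<phi> \<psi>)"
    by (metis subformulas_refl)
  with Until show ?case
    unfolding sat_build_Until by simp
next
  case (Globally \<phi>)
  then have "sat w (Globally \<phi>) \<longleftrightarrow> sat w' (Globally \<phi>)"
    by (metis subformulas_refl)
  with Globally show ?case
    unfolding sat_build_Globally by simp
qed auto

lemma sat_conc_cong:
  assumes "\<forall>\<chi> \<in> subformulas \<phi>. sat w \<chi> \<longleftrightarrow> sat w' \<chi>"
  shows "sat (u \<frown> w) \<phi> \<longleftrightarrow> sat (u \<frown> w') \<phi>"
proof -
  \<comment> \<open>Strengthened from \<open>\<phi>\<close> to all its subformulas, because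
    \<open>sat_build_cong\<close> needs agreement on all of them to absorb one more letter.\<close>
  have "\<forall>\<chi> \<in> subformulas \<phi>. sat (u \<frown> w) \<chi> \<longleftrightarrow> sat (u \<frown> w') \<chi>"
  proof (induction u)
    case Nil
    then show ?case using assms by simp
  next
    case (Cons a u)
    then show ?case
      using subformulas_trans[of _ \<phi>]
      by (simp add: sat_build_cong subset_iff)
  qed
  then show ?thesis
    by (simp add: subformulas_refl)
qed

lemma finite_residuals: "finite (range (residual {w. sat w \<phi>}))"
proof -
  define theory_of where "theory_of w = {\<chi> \<in> subformulas \<phi>. sat w \<chi>}" for w
  have "residual {w. sat w \<phi>} u \<in> (\<lambda>A. {w. theory_of w \<in> A}) ` Pow (Pow (subformulas \<phi>))" for u
  proof (rule image_eqI)
    \<comment> \<open>Words with equal theories lie in the same residuals, so a residual is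
      recovered from the set of theories of its members.\<close>
    show "theory_of ` residual {w. sat w \<phi>} u \<in> Pow (Pow (subformulas \<phi>))"
      by (auto simp: theory_of_def)
    have "sat (u \<frown> w) \<phi>" if "theory_of w = theory_of w'" "sat (u \<frown> w') \<phi>" for w w'
    proof -
      have "\<forall>\<chi> \<in> subformulas \<phi>. sat w \<chi> \<longleftrightarrow> sat w' \<chi>"
        using that(1) unfolding theory_of_def by blast
      then show ?thesis
        using sat_conc_cong that(2) by blast
    qed
    then show "residual {w. sat w \<phi>} u = {w. theory_of w \<in> theory_of ` residual {w. sat w \<phi>} u}"
      by (auto simp: residual_def)
  qed
  then have "range (residual {w. sat w \<phi>}) \<subseteq>
      (\<lambda>A. {w. theory_of w \<in> A}) ` Pow (Pow (subformulas \<phi>))"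
    by blast
  then show ?thesis
    by (rule finite_subset) (simp add: finite_subformulas)
qed

section \<open>Bad prefixes of safe formulas\<close>

lemma syntactically_safe_bad_prefix:
  assumes "syntactically_safe \<phi>" "\<not> sat w \<phi>"
  shows "\<exists>n. \<forall>w'. (\<forall>t<n. w' t = w t) \<longrightarrow> \<not> sat w' \<phi>"
  using assms
proof (induction arbitrary: w)
  case (1 x)
  then show ?case by (intro exI[of _ 1]) simp
next
  case (2 x)
  then show ?case by (intro exI[of _ 1]) simp
next
  case (3 \<phi> \<psi>)
  then obtain m n where "\<forall>w'. (\<forall>t<m. w' t = w t) \<longrightarrow> \<not> sat w' \<phi>"
    "\<forall>w'. (\<forall>t<n. w' t = w t) \<longrightarrow> \<not> sat w' \<psi>"
    by (metis sat.simps(3))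
  then show ?case
    by (intro exI[of _ "max m n"]) auto
next
  case (4 \<phi> \<psi>)
  then show ?case by (metis sat.simps(4))
next
  case (5 \<phi>)
  then obtain n where "\<forall>w'. (\<forall>t<n. w' t = suffix 1 w t) \<longrightarrow> \<not> sat w' \<phi>"
    by (metis sat.simps(5))
  then show ?case
    by (intro exI[of _ "Suc n"]) auto
next
  case (6 \<phi>)
  then obtain k where "\<not> sat (suffix k w) \<phi>"
    by auto
  with 6 obtain n where "\<forall>w'. (\<forall>t<n. w' t = suffix k w t) \<longrightarrow> \<not> sat w' \<phi>"
    by blast
  then have "\<not> sat (suffix k w') \<phi>" if "\<forall>t<k + n. w' t = w t" for w'
    using that by simp
  then show ?case
    by (intro exI[of _ "k + n"]) auto
next
  case (7 \<phi> \<psi>)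
  then obtain k where k: "\<not> sat (suffix k w) \<psi>" "\<forall>j<k. \<not> sat (suffix j w) \<phi>"
    by auto
  with 7 obtain n where n: "\<forall>w'. (\<forall>t<n. w' t = suffix k w t) \<longrightarrow> \<not> sat w' \<psi>"
    by blast
  have "\<forall>j<k. \<exists>m. \<forall>w'. (\<forall>t<m. w' t = suffix j w t) \<longrightarrow> \<not> sat w' \<phi>"
    using k(2) 7 by blast
  then obtain m where m: "\<forall>j<k. \<forall>w'. (\<forall>t<m j. w' t = suffix j w t) \<longrightarrow> \<not> sat w' \<phi>"
    by metis
  \<comment> \<open>A violated \<open>Release\<close> is witnessed by finitely many violations, of
    \<open>\<psi>\<close> at \<open>k\<close> and of \<open>\<phi>\<close> at each
    \<open>j < k\<close>. The sum dominates every \<open>m j\<close>, so one prefix of length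
    \<open>N\<close> preserves them all.\<close>
  define N where "N = k + n + (\<Sum>j<k. m j)"
  have "\<not> sat w' (Release \<phi> \<psi>)" if w': "\<forall>t<N. w' t = w t" for w'
  proof -
    have "\<not> sat (suffix k w') \<psi>"
      using n w' by (simp add: N_def)
    moreover have "\<not> sat (suffix j w') \<phi>" if "j < k" for j
    proof -
      have "m j \<le> (\<Sum>j<k. m j)"
        using that by (intro member_le_sum) auto
      then have "j + m j \<le> N"
        using that unfolding N_def by linarith
      then show ?thesis
        using m w' that by simp
    qed
    ultimately show ?thesis by auto
  qed
  then show ?case by blast
qed

section \<open>The game on residual languages\<close>

text \<open>Finite counterexamples for arbitrary languages, since the game passes to residuals,
  which are not given by formulas.\<close>

definition refutes :: "'a set \<Rightarrow> 'a set \<Rightarrow> 'a set word set \<Rightarrow> 'a set word set \<Rightarrow> bool" where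
  "refutes Inp Out L P \<longleftrightarrow>
     finite P \<and> P \<subseteq> input_words Inp \<and>
     (\<forall>f. implementation Inp Out f \<longrightarrow> (\<exists>\<sigma> \<in> P. run f \<sigma> \<notin> L))"

definition winning :: "'a set \<Rightarrow> 'a set \<Rightarrow> 'a set word set \<Rightarrow> bool" where
  "winning Inp Out L \<longleftrightarrow> (\<nexists>P. refutes Inp Out L P)"

lemma not_winning_empty: "\<not> winning Inp Out {}"
proof -
  have "refutes Inp Out {} {\<lambda>_. {}}"
    by (simp add: refutes_def input_words_def)
  then show ?thesis
    by (auto simp: winning_def)
qed

text \<open>The first output is \<open>f []\<close>, whatever the first input. Hence
  \<open>winning_output\<close> can fix \<open>b\<close> before \<open>i\<close> is known.\<close>

lemma run_build: "run f (i ## \<sigma>) = (i \<union> f []) ## run (\<lambda>u. f (i # u)) \<sigma>"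
proof
  fix t
  have "(i ## \<sigma>) \<circ> Suc = \<sigma>"
    by (simp add: fun_eq_iff)
  then show "run f (i ## \<sigma>) t = ((i \<union> f []) ## run (\<lambda>u. f (i # u)) \<sigma>) t"
    by (cases t) (simp_all add: run_def subsequence_def upt_conv_Cons map_Suc_upt[symmetric]
      del: upt_Suc)
qed

lemma implementation_shift:
  "implementation Inp Out f \<Longrightarrow> i \<subseteq> Inp \<Longrightarrow> implementation Inp Out (\<lambda>u. f (i # u))"
  by (simp add: implementation_def)

lemma winning_output:
  assumes "finite Out" "winning Inp Out L"
  shows "\<exists>b \<subseteq> Out. \<forall>i \<subseteq> Inp. winning Inp Out (residual L [i \<union> b])"
proof (rule ccontr)
  assume "\<not> ?thesis"
  then have "\<forall>b \<in> Pow Out. \<exists>i P. i \<subseteq> Inp \<and> refutes Inp Out (residual L [i \<union> b]) P"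
    by (simp add: winning_def)
  then obtain i P where iP: "\<forall>b \<in> Pow Out. i b \<subseteq> Inp \<and> refutes Inp Out (residual L [i b \<union> b]) (P b)"
    by metis
  define P' where "P' = (\<Union>b \<in> Pow Out. (\<lambda>\<sigma>. i b ## \<sigma>) ` P b)"
  have "finite P'"
    using assms(1) iP by (simp add: P'_def refutes_def)
  moreover have "P' \<subseteq> input_words Inp"
  proof
    fix \<tau> assume "\<tau> \<in> P'"
    then obtain b \<sigma> where b: "b \<in> Pow Out" "\<sigma> \<in> P b" and \<tau>: "\<tau> = i b ## \<sigma>"
      by (auto simp: P'_def)
    with iP have "i b \<subseteq> Inp" "\<forall>t. \<sigma> t \<subseteq> Inp"
      by (auto simp: refutes_def input_words_def)
    then have "\<tau> t \<subseteq> Inp" for t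
      unfolding \<tau> by (cases t) simp_all
    then show "\<tau> \<in> input_words Inp"
      by (simp add: input_words_def)
  qed
  moreover have "\<exists>\<tau> \<in> P'. run f \<tau> \<notin> L" if f: "implementation Inp Out f" for f
  proof -
    \<comment> \<open>The first output selects the piece of \<open>P'\<close> that defeats
      \<open>f\<close>: after input \<open>i b\<close>, the rest of \<open>f\<close> faces
      \<open>P b\<close>.\<close>
    define b where "b = f []"
    have b: "b \<in> Pow Out"
      using f by (simp add: implementation_def b_def)
    with iP have "i b \<subseteq> Inp" and P: "refutes Inp Out (residual L [i b \<union> b]) (P b)"
      by blast+
    with f have "implementation Inp Out (\<lambda>u. f (i b # u))"
      by (simp add: implementation_shift)
    with P obtain \<sigma> where \<sigma>: "\<sigma> \<in> P b" "run (\<lambda>u. f (i b # u)) \<sigma> \<notin> residual L [i b \<union> b]"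
      unfolding refutes_def by blast
    then have "run f (i b ## \<sigma>) \<notin> L"
      by (simp add: run_build residual_def b_def)
    with b \<sigma>(1) show ?thesis
      by (auto simp: P'_def)
  qed
  ultimately show False
    using assms(2) unfolding winning_def refutes_def by blast
qed

section \<open>From a winning language to a transducer\<close>

text \<open>Renames states to natural numbers, as \<open>finite_state\<close> requires; the
  transducer built below has languages as states.\<close>

lemma finite_state_transducer:
  fixes T :: "('q, 'a) transducer"
  assumes T: "finite_transducer Inp Out T"
  shows "finite_state Inp Out (\<lambda>u. label T (foldl (step T) (initial T) u))"
proof -
  obtain h :: "'q \<Rightarrow> nat" where h: "inj_on h (states T)"
    using T finite_imp_inj_to_nat_seg unfolding finite_transducer_def by metis
  define g where "g = inv_into (states T) h"
  have g: "g (h q) = q" if "q \<in> states T" for q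
    using h that by (simp add: g_def)
  define T' :: "(nat, 'a) transducer" where
    "T' = \<lparr>states = h ` states T, initial = h (initial T),
           step = (\<lambda>n a. h (step T (g n) a)), label = (\<lambda>n. label T (g n))\<rparr>"
  have "finite_transducer Inp Out T'"
    using T by (auto simp: finite_transducer_def T'_def g)
  \<comment> \<open>Membership in \<open>states T\<close> is carried along because \<open>g\<close>
    is known to invert \<open>h\<close> only there.\<close>
  moreover have "foldl (step T) (initial T) u \<in> states T \<and>
      foldl (step T') (initial T') u = h (foldl (step T) (initial T) u)"
    if "u \<in> lists (Pow Inp)" for u
    using that
  proof (induction u rule: rev_induct)
    case Nil
    then show ?case using T by (simp add: finite_transducer_def T'_def)
  next
    case (snoc a u)
    then show ?case using T by (auto simp: finite_transducer_def T'_def g)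
  qed
  ultimately show ?thesis
    unfolding finite_state_def by (intro exI[of _ T']) (auto simp: T'_def g)
qed

lemma implementation_transducer:
  assumes T: "finite_transducer Inp Out T"
  shows "implementation Inp Out (\<lambda>u. label T (foldl (step T) (initial T) u))"
proof -
  have "foldl (step T) (initial T) u \<in> states T" if "u \<in> lists (Pow Inp)" for u
    using that
    by (induction u rule: rev_induct) (use T in \<open>auto simp: finite_transducer_def\<close>)
  then show ?thesis
    using T by (auto simp: implementation_def finite_transducer_def)
qed

text \<open>The premise \<open>closed\<close> is the safety property: \<open>L\<close> contains
  every word all of whose prefixes extend into \<open>L\<close>.\<close>

lemma winning_imp_finite_transducer:
  fixes L :: "'a set word set"
  assumes Out: "finite Out"
    and fin: "finite (range (residual L))"
    and closed: "\<And>w. (\<And>n. \<exists>v. prefix n w \<frown> v \<in> L) \<Longrightarrow> w \<in> L"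
    and win: "winning Inp Out L"
  shows "\<exists>T :: ('a set word set, 'a) transducer. finite_transducer Inp Out T \<and>
    (\<forall>\<sigma> \<in> input_words Inp. run (\<lambda>u. label T (foldl (step T) (initial T) u)) \<sigma> \<in> L)"
proof -
  \<comment> \<open>The bound \<open>b \<subseteq> Out\<close> is demanded of losing
    \<open>M\<close> too, since some residuals of \<open>L\<close> may be losing and every state
    needs a legal label.\<close>
  have "\<forall>M. \<exists>b. b \<subseteq> Out \<and> (winning Inp Out M \<longrightarrow>
      (\<forall>i \<subseteq> Inp. winning Inp Out (residual M [i \<union> b])))"
    (is "\<forall>M. ?choice M")
  proof
    fix M
    show "?choice M"
      using winning_output[OF Out, of Inp M] by (cases "winning Inp Out M") auto
  qed
  then obtain out where out: "\<And>M. out M \<subseteq> Out"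
    and keep: "\<And>M i. winning Inp Out M \<Longrightarrow> i \<subseteq> Inp \<Longrightarrow>
      winning Inp Out (residual M [i \<union> out M])"
    by metis
  define T where "T = \<lparr>states = range (residual L), initial = L,
    step = (\<lambda>M i. residual M [i \<union> out M]), label = out\<rparr>"
  define f where "f u = label T (foldl (step T) (initial T) u)" for u
  have "L \<in> range (residual L)"
    by (metis rangeI residual_Nil)
  with fin out have "finite_transducer Inp Out T"
    by (auto simp: finite_transducer_def T_def residual_residual)
  moreover have "run f \<sigma> \<in> L" if \<sigma>: "\<sigma> \<in> input_words Inp" for \<sigma>
  proof (rule closed)
    fix n
    \<comment> \<open>The transducer reads inputs only, but adds its own output to each, so its
      state is the residual by the prefix of the run.\<close>
    have "foldl (step T) (initial T) (prefix n \<sigma>) = residual L (prefix n (run f \<sigma>)) \<and>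
        winning Inp Out (residual L (prefix n (run f \<sigma>)))"
    proof (induction n)
      case 0
      then show ?case using win by (simp add: T_def)
    next
      case (Suc n)
      let ?M = "residual L (prefix n (run f \<sigma>))"
      have "f (prefix n \<sigma>) = out ?M"
        unfolding f_def[of "prefix n \<sigma>"] using Suc by (simp add: T_def)
      then have "residual L (prefix (Suc n) (run f \<sigma>)) = residual ?M [\<sigma> n \<union> out ?M]"
        by (simp add: residual_residual run_def)
      moreover have "foldl (step T) (initial T) (prefix (Suc n) \<sigma>) = residual ?M [\<sigma> n \<union> out ?M]"
        using Suc by (simp add: T_def)
      moreover have "\<sigma> n \<subseteq> Inp"
        using \<sigma> by (simp add: input_words_def)
      ultimately show ?case
        using keep Suc by simp
    qed
    then have "residual L (prefix n (run f \<sigma>)) \<noteq> {}"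
      using not_winning_empty by metis
    then show "\<exists>v. prefix n (run f \<sigma>) \<frown> v \<in> L"
      by (auto simp: residual_def)
  qed
  ultimately show ?thesis
    unfolding f_def by blast
qed

theorem theorem5p4:
  fixes Inp Out :: "'a set" and \<phi> :: "'a ltl"
  assumes "finite Inp" and "finite Out" and "Inp \<inter> Out = {}"
    and "atoms \<phi> \<subseteq> Inp \<union> Out"
    and "syntactically_safe \<phi>"
  shows "unrealizable Inp Out \<phi> \<longleftrightarrow> (\<exists>P. finite_counterexample Inp Out \<phi> P)"
proof
  assume unreal: "unrealizable Inp Out \<phi>"
  let ?L = "{w. sat w \<phi>}"
  have closed: "w \<in> ?L" if w: "\<And>n. \<exists>v. prefix n w \<frown> v \<in> ?L" for w
  proof (rule ccontr)
    assume "w \<notin> ?L"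
    then obtain n where n: "\<forall>w'. (\<forall>t<n. w' t = w t) \<longrightarrow> \<not> sat w' \<phi>"
      using syntactically_safe_bad_prefix[OF assms(5)] by blast
    obtain v where "sat (prefix n w \<frown> v) \<phi>"
      using w by blast
    moreover have "\<forall>t<n. (prefix n w \<frown> v) t = w t"
      by (simp add: conc_def)
    ultimately show False
      using n by blast
  qed
  have "\<not> winning Inp Out ?L"
  proof
    assume "winning Inp Out ?L"
    then obtain T :: "('a set word set, 'a) transducer" where
      "finite_transducer Inp Out T"
      "\<forall>\<sigma> \<in> input_words Inp. run (\<lambda>u. label T (foldl (step T) (initial T) u)) \<sigma> \<in> ?L"
      using winning_imp_finite_transducer[OF assms(2) finite_residuals closed] by blast
    then have "realizable Inp Out \<phi>"
      using finite_state_transducer implementation_transducer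
      unfolding realizable_def by blast
    with unreal show False by blast
  qed
  then show "\<exists>P. finite_counterexample Inp Out \<phi> P"
    by (auto simp: winning_def refutes_def finite_counterexample_def)
next
  \<comment> \<open>A finite counterexample defeats all implementations, in particular the
    finite-state ones.\<close>
  assume "\<exists>P. finite_counterexample Inp Out \<phi> P"
  then show "unrealizable Inp Out \<phi>"
    unfolding finite_counterexample_def realizable_def by blast
qed

end
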